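(* Let $\mathsf{p}_1,\dots,\mathsf{p}_N\in\mathbb{C}^{n_p}$ and $y_1,\dots,y_N\in\mathbb{C}^{n_o\times n_f}$ be samples such that the collection of pairs $(\mathsf{p}_\ell,y_\ell)$ is closed under conjugation (for each $\ell$ the pair $(\overline{\mathsf{p}_\ell},\overline{y_\ell})$ also occurs among the samples). Let $\mathcal{P}=\{\mathsf{p}_1,\dots,\mathsf{p}_N\}$, $\mu=\frac1N\sum_{\ell=1}^N\delta_{\mathsf{p}_\ell}$, and let $\hat\alpha_i,\hat\beta_j,\hat\gamma_k:\mathcal{P}\to\mathbb{C}$ ($i=1,\dots,q_A$, $j=1,\dots,q_B$, $k=1,\dots,q_C$) be functions with $f(\overline{\mathsf{p}})=\overline{f(\mathsf{p})}$ for each such $f$, satisfying \[ \int_{\mathcal{P}}\left(\frac{\sum_{j}|\hat\beta_j(\mathsf{p})|\,\sum_{k}|\hat\gamma_k(\mathsf{p})|}{\sum_{i}|\hat\alpha_i(\mathsf{p})|}\right)^{2}d\mu(\mathsf{p})<\infty . \] For $(\hat A_i,\hat B_j,\hat C_k)\in(\mathbb{R}^{r\times r})^{q_A}\times(\mathbb{R}^{r\times n_f})^{q_B}\times(\mathbb{R}^{n_o\times r})^{q_C}$ let $\hat{\mathcal{A}}(\mathsf{p})=\sum_i\hat\alpha_i(\mathsf{p})\hat A_i$, $\hat{\mathcal{B}}(\mathsf{p})=\sum_j\hat\beta_j(\mathsf{p})\hat B_j$, $\hat{\mathcal{C}}(\mathsf{p})=\sum_k\hat\gamma_k(\mathsf{p})\hat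 C_k$, and suppose the tuple lies in the set $\mathcal{R}$ of tuples with $\operatorname*{ess\,sup}_{\mathsf{p}\in\mathcal{P}}\|\hat\alpha_i(\mathsf{p})\hat{\mathcal{A}}(\mathsf{p})^{-1}\|_F<\infty$ for all $i$ (essential supremum w.r.t. $\mu$). Define $\hat x(\mathsf{p})=\hat{\mathcal{A}}(\mathsf{p})^{-1}\hat{\mathcal{B}}(\mathsf{p})$, $\hat y(\mathsf{p})=\hat{\mathcal{C}}(\mathsf{p})\hat x(\mathsf{p})$, $\hat x_d(\mathsf{p})=\hat{\mathcal{A}}(\mathsf{p})^{-*}\hat{\mathcal{C}}(\mathsf{p})^*$ and \[ \mathcal{J}_{\mathrm{MSE}}=\frac1N\sum_{\ell=1}^N\|y_\ell-\hat y(\mathsf{p}_\ell)\|_F^2 . \] Then the gradients of $\mathcal{J}_{\mathrm{MSE}}$ with respect to the reduced matrices are \begin{align*} \nabla_{\hat A_i}\mathcal{J}_{\mathrm{MSE}}&=\frac2N\sum_{\ell=1}^N\hat\alpha_i(\overline{\mathsf{p}_\ell})\,\hat x_d(\mathsf{p}_\ell)\,[y_\ell-\hat y(\mathsf{p}_\ell)]\,\hat x(\mathsf{p}_\ell)^*,&i=1,\dots,q_A,\\ \nabla_{\hat B_j}\mathcal{J}_{\mathrm{MSE}}&=\frac2N\sum_{\ell=1}^N\hat\beta_j(\overline{\mathsf{p}_\ell})\,\hat x_d(\mathsf{p}_\ell)\,[\hat y(\mathsf{p}_\ell)-y_\ell],&j=1,\dots,q_B,\\ \nabla_{\hat C_k}\mathcal{J}_{\mathrm{MSE}}&=\frac2N\sum_{\ell=1}^N\hat\gamma_k(\overline{\mathsf{p}_\ell})\,[\hat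 y(\mathsf{p}_\ell)-y_\ell]\,\hat x(\mathsf{p}_\ell)^*,&k=1,\dots,q_C. \end{align*}
   Context: $\delta_x$ is the Dirac measure at $x$; $\|\cdot\|_F$ the Frobenius norm; $(\cdot)^*$ the conjugate transpose and $M^{-*}=(M^{-1})^*$. Gradients are taken with respect to the real Frobenius inner product $\langle X,Y\rangle=\operatorname{trace}(X^{\mathrm T}Y)$ on real matrices, i.e. $\nabla f(x)$ is the unique element with $f(x+h)=f(x)+\langle\nabla f(x),h\rangle+o(\|h\|)$. *)

theory Defs
  imports "HOL-Analysis.Analysis" "HOL-Probability.Probability"
begin

text \<open>Complex matrices are 'complex ^ 'cols ^ 'rows'; real matrices 'real ^ 'cols ^ 'rows'.\<close>

definition cmat :: "real^'n^'m \<Rightarrow> complex^'n^'m" where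
  "cmat M = (\<chi> a b. complex_of_real (M$a$b))"

definition remat :: "complex^'n^'m \<Rightarrow> real^'n^'m" where
  "remat M = (\<chi> a b. Re (M$a$b))"

definition smat :: "complex \<Rightarrow> complex^'n^'m \<Rightarrow> complex^'n^'m" where
  "smat c M = (\<chi> a b. c * M$a$b)"

text \<open>entrywise conjugate of a matrix / vector, and the conjugate transpose\<close>
definition mconj :: "complex^'n^'m \<Rightarrow> complex^'n^'m" where
  "mconj M = (\<chi> a b. cnj (M$a$b))"

definition vconj :: "complex^'n \<Rightarrow> complex^'n" where
  "vconj v = (\<chi> a. cnj (v$a))"

definition cadj :: "complex^'n^'m \<Rightarrow> complex^'m^'n" where
  "cadj M = (\<chi> a b. cnj (M$b$a))"

definition frob :: "complex^'n^'m \<Rightarrow> real" where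
  "frob M = sqrt (\<Sum>a\<in>UNIV. \<Sum>b\<in>UNIV. (cmod (M$a$b))^2)"

text \<open>parametric matrix  p \<mapsto> sum_{i<q} f_i(p) M_i\<close>
definition pmat :: "nat \<Rightarrow> (nat \<Rightarrow> 'p \<Rightarrow> complex) \<Rightarrow> (nat \<Rightarrow> real^'n^'m) \<Rightarrow> 'p \<Rightarrow> complex^'n^'m" where
  "pmat q f M p = (\<Sum>i<q. smat (f i p) (cmat (M i)))"

definition xhat :: "nat \<Rightarrow> (nat \<Rightarrow> 'p \<Rightarrow> complex) \<Rightarrow> (nat \<Rightarrow> real^'r^'r)
    \<Rightarrow> nat \<Rightarrow> (nat \<Rightarrow> 'p \<Rightarrow> complex) \<Rightarrow> (nat \<Rightarrow> real^'f^'r) \<Rightarrow> 'p \<Rightarrow> complex^'f^'r" where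
  "xhat qA \<alpha> A qB \<beta> B p = matrix_inv (pmat qA \<alpha> A p) ** pmat qB \<beta> B p"

definition yhat :: "nat \<Rightarrow> (nat \<Rightarrow> 'p \<Rightarrow> complex) \<Rightarrow> (nat \<Rightarrow> real^'r^'r)
    \<Rightarrow> nat \<Rightarrow> (nat \<Rightarrow> 'p \<Rightarrow> complex) \<Rightarrow> (nat \<Rightarrow> real^'f^'r)
    \<Rightarrow> nat \<Rightarrow> (nat \<Rightarrow> 'p \<Rightarrow> complex) \<Rightarrow> (nat \<Rightarrow> real^'r^'o) \<Rightarrow> 'p \<Rightarrow> complex^'f^'o" where
  "yhat qA \<alpha> A qB \<beta> B qC \<gamma> C p = pmat qC \<gamma> C p ** xhat qA \<alpha> A qB \<beta> B p"

text \<open>dual state  A(p)^{-*} C(p)^*\<close>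
definition xdual :: "nat \<Rightarrow> (nat \<Rightarrow> 'p \<Rightarrow> complex) \<Rightarrow> (nat \<Rightarrow> real^'r^'r)
    \<Rightarrow> nat \<Rightarrow> (nat \<Rightarrow> 'p \<Rightarrow> complex) \<Rightarrow> (nat \<Rightarrow> real^'r^'o) \<Rightarrow> 'p \<Rightarrow> complex^'o^'r" where
  "xdual qA \<alpha> A qC \<gamma> C p = cadj (matrix_inv (pmat qA \<alpha> A p)) ** cadj (pmat qC \<gamma> C p)"

text \<open>mean squared error over the samples P 0..P (N-1), Y 0..Y (N-1)\<close>
definition Jmse :: "nat \<Rightarrow> (nat \<Rightarrow> 'p) \<Rightarrow> (nat \<Rightarrow> complex^'f^'o)
    \<Rightarrow> nat \<Rightarrow> (nat \<Rightarrow> 'p \<Rightarrow> complex) \<Rightarrow> (nat \<Rightarrow> real^'r^'r)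
    \<Rightarrow> nat \<Rightarrow> (nat \<Rightarrow> 'p \<Rightarrow> complex) \<Rightarrow> (nat \<Rightarrow> real^'f^'r)
    \<Rightarrow> nat \<Rightarrow> (nat \<Rightarrow> 'p \<Rightarrow> complex) \<Rightarrow> (nat \<Rightarrow> real^'r^'o) \<Rightarrow> real" where
  "Jmse N P Y qA \<alpha> A qB \<beta> B qC \<gamma> C =
     (1 / real N) * (\<Sum>l<N. (frob (Y l - yhat qA \<alpha> A qB \<beta> B qC \<gamma> C (P l)))^2)"

text \<open>empirical measure  mu = (1/N) sum_l delta_{P l}\<close>
definition empmeas :: "nat \<Rightarrow> (nat \<Rightarrow> 'p) \<Rightarrow> 'p measure" where
  "empmeas N P = measure_pmf (pmf_of_multiset (mset (map P [0..<N])))"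

text \<open>the set R of admissible reduced tuples (A is invertible mu-a.e. and the
  essential suprema of the Frobenius norms of alpha_i(p) A(p)^{-1} are finite)\<close>
definition inR :: "'p measure \<Rightarrow> nat \<Rightarrow> (nat \<Rightarrow> 'p \<Rightarrow> complex) \<Rightarrow> (nat \<Rightarrow> real^'r^'r) \<Rightarrow> bool" where
  "inR \<mu> qA \<alpha> A \<longleftrightarrow> (AE p in \<mu>. invertible (pmat qA \<alpha> A p)) \<and>
     (\<forall>i<qA. esssup \<mu> (\<lambda>p. ereal (frob (smat (\<alpha> i p) (matrix_inv (pmat qA \<alpha> A p))))) < \<infinity>)"

end

theory Submission
  imports Defs
begin

(* The gradient with respect to a reduced matrix is read off from the Frechet derivative of
   J_MSE by moving the derivative of each residual to the other side of the real Frobenius inner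
   product <E, F> = Re tr (E (cadj F)).  Varying A_i perturbs A(p)^-1 by
   -A(p)^-1 (alpha_i(p) H) A(p)^-1; the adjoints of the outer factors C(p) A(p)^-1 and B(p)
   produce x_d(p) and cadj (x(p)), and moving alpha_i(p) across the inner product conjugates it.
   The resulting complex matrix is real: conjugation permutes the samples and maps each summand
   to the summand of the partner sample, so the sum equals its own conjugate. *)

section \<open>Derivative of the matrix inverse\<close>

lemma matrix_inv_right:
  "invertible (A::'a::semiring_1^'n^'m) \<Longrightarrow> A ** matrix_inv A = mat 1"
  unfolding matrix_inv_def invertible_def by (rule someI2_ex) auto

lemma matrix_inv_left:
  "invertible (A::'a::semiring_1^'n^'m) \<Longrightarrow> matrix_inv A ** A = mat 1"
  unfolding matrix_inv_def invertible_def by (rule someI2_ex) auto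

lemma matrix_inv_unique:
  fixes A :: "'a::semiring_1^'n^'m"
  assumes "A ** B = mat 1" "B ** A = mat 1"
  shows "matrix_inv A = B"
proof -
  have "invertible A" using assms unfolding invertible_def by blast
  have "matrix_inv A = matrix_inv A ** (A ** B)"
    by (simp add: assms(1))
  also have "\<dots> = B"
    using \<open>invertible A\<close> by (simp add: matrix_mul_assoc matrix_inv_left)
  finally show ?thesis .
qed

lemma bounded_bilinear_matrix_mult:
  "bounded_bilinear
     ((**) :: 'a::{real_normed_algebra_1,euclidean_space}^'n^'m \<Rightarrow> 'a^'k^'n \<Rightarrow> 'a^'k^'m)"
  unfolding bilinear_conv_bounded_bilinear[symmetric] bilinear_def
  by (auto intro!: linearI simp: vec_eq_iff matrix_matrix_mult_def sum.distrib
      distrib_left distrib_right scaleR_sum_right)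

interpretation matrix_mult:
  bounded_bilinear "(**) :: 'a::{real_normed_algebra_1,euclidean_space}^'n^'m \<Rightarrow> 'a^'k^'n \<Rightarrow> 'a^'k^'m"
  by (rule bounded_bilinear_matrix_mult)

lemma matrix_diff_ldistrib: "(A::'a::ring_1^'n^'m) ** (B - C) = A ** B - A ** C"
  by (simp add: vec_eq_iff matrix_matrix_mult_def right_diff_distrib sum_subtractf)

lemma matrix_diff_rdistrib: "((A::'a::ring_1^'n^'m) - B) ** C = A ** C - B ** C"
  by (simp add: vec_eq_iff matrix_matrix_mult_def left_diff_distrib sum_subtractf)

lemma matrix_inv_diff:
  fixes Z Z0 :: "'a::comm_ring_1^'n^'n"
  assumes "invertible Z" "invertible Z0"
  shows "matrix_inv Z - matrix_inv Z0 = - (matrix_inv Z ** (Z - Z0) ** matrix_inv Z0)"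
  using assms by (simp add: matrix_diff_ldistrib matrix_diff_rdistrib matrix_inv_left
      matrix_inv_right flip: matrix_mul_assoc)

lemma matrix_inv_cramer:
  fixes Z :: "'a::field^'n^'n"
  assumes "det Z \<noteq> 0"
  shows "matrix_inv Z $ k $ j = det (\<chi> a b. if b = k then axis j 1 $ a else Z $ a $ b) / det Z"
proof -
  have "Z *v (matrix_inv Z *v axis j 1) = axis j 1"
    using assms by (simp add: matrix_vector_mul_assoc matrix_inv_right invertible_det_nz)
  then have "matrix_inv Z *v axis j 1
      = (\<chi> k. det (\<chi> a b. if b = k then axis j 1 $ a else Z $ a $ b) / det Z)"
    using cramer[OF assms] by blast
  moreover have "(matrix_inv Z *v axis j 1) $ k = matrix_inv Z $ k $ j"
    by (simp add: matrix_vector_mult_def axis_def mult.commute[of _ "if _ then _ else _"]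
        if_distrib[of "\<lambda>x. x * _"] cong: if_cong)
  ultimately show ?thesis by simp
qed

lemma isCont_det: "isCont (det :: 'a::real_normed_field^'n^'n \<Rightarrow> 'a) Z"
  unfolding det_def by (intro continuous_intros)

lemma eventually_invertible_nhds:
  fixes Z0 :: "'a::real_normed_field^'n^'n"
  assumes "invertible Z0"
  shows "\<forall>\<^sub>F Z in nhds Z0. invertible Z"
proof -
  have "(det \<longlongrightarrow> det Z0) (nhds Z0)"
    using isCont_det[of Z0] by (simp add: isCont_def tendsto_nhds_iff)
  then have "\<forall>\<^sub>F Z in nhds Z0. det Z \<noteq> 0"
    using assms by (simp add: invertible_det_nz tendsto_imp_eventually_ne)
  then show ?thesis by (simp add: invertible_det_nz)
qed

lemma isCont_matrix_inv:
  fixes Z0 :: "'a::real_normed_field^'n^'n"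
  assumes "invertible Z0"
  shows "isCont matrix_inv Z0"
proof -
  let ?cramer = "\<lambda>Z. \<chi> k j. det (\<chi> a b. if b = k then axis j 1 $ a else Z $ a $ b) / det Z"
  have "\<forall>\<^sub>F Z in nhds Z0. matrix_inv Z = ?cramer Z"
    using eventually_invertible_nhds[OF assms]
    by eventually_elim (simp add: vec_eq_iff matrix_inv_cramer invertible_det_nz)
  moreover have "isCont ?cramer Z0"
    using assms unfolding isCont_def invertible_det_nz
    by (auto intro!: tendsto_intros isCont_tendsto_compose[OF isCont_det])
  ultimately show ?thesis by (simp add: isCont_cong)
qed

lemma has_derivative_matrix_inv:
  fixes Z0 :: "'a::{real_normed_field,euclidean_space}^'n^'n"
  assumes "invertible Z0"
  shows "(matrix_inv has_derivative (\<lambda>H. - (matrix_inv Z0 ** H ** matrix_inv Z0))) (at Z0)"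
proof -
  let ?Zi = "matrix_inv Z0"
  obtain K where K: "K > 0" "\<And>(X :: 'a^'n^'n) (Y :: 'a^'n^'n). norm (X ** Y) \<le> norm X * norm Y * K"
    using matrix_mult.pos_bounded by blast
  let ?c = "\<lambda>Z. norm (?Zi - matrix_inv Z) * K * norm ?Zi * K"
  have remainder_le: "norm (matrix_inv Z - ?Zi - - (?Zi ** (Z - Z0) ** ?Zi)) \<le> ?c Z * norm (Z - Z0)"
    if "invertible Z" for Z
  proof -
    have "matrix_inv Z - ?Zi - - (?Zi ** (Z - Z0) ** ?Zi) = (?Zi - matrix_inv Z) ** (Z - Z0) ** ?Zi"
      using matrix_inv_diff[OF that assms] by (simp add: matrix_diff_rdistrib)
    also have "norm \<dots> \<le> norm ((?Zi - matrix_inv Z) ** (Z - Z0)) * norm ?Zi * K"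
      by (rule K(2))
    also have "\<dots> \<le> norm (?Zi - matrix_inv Z) * norm (Z - Z0) * K * norm ?Zi * K"
      using K by (intro mult_right_mono K(2)) auto
    finally show ?thesis by (simp add: ac_simps)
  qed
  have "\<forall>\<^sub>F Z in at Z0.
      norm (norm (matrix_inv Z - ?Zi - - (?Zi ** (Z - Z0) ** ?Zi)) / norm (Z - Z0)) \<le> ?c Z"
    using eventually_invertible_nhds[OF assms] unfolding eventually_at_filter
    by eventually_elim (auto simp: divide_le_eq dest: remainder_le)
  moreover have "(?c \<longlongrightarrow> 0) (at Z0)"
    using isCont_matrix_inv[OF assms] unfolding isCont_def
    by (auto intro!: tendsto_eq_intros)
  moreover have "bounded_linear (\<lambda>H. - (?Zi ** H ** ?Zi))"
    by (intro bounded_linear_minus bounded_linear_compose[OF matrix_mult.bounded_linear_left]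
        matrix_mult.bounded_linear_right)
  ultimately show ?thesis
    unfolding has_derivative_iff_norm by (auto intro: Lim_null_comparison)
qed

section \<open>Adjoints for the real Frobenius inner product\<close>

lemma frob_eq_norm: "frob M = norm M"
  unfolding frob_def norm_vec_def L2_set_def by (simp add: sum_nonneg)

lemma inner_cmatrix:
  "inner (E::complex^'n^'m) F = (\<Sum>a\<in>UNIV. \<Sum>b\<in>UNIV. Re (E $ a $ b * cnj (F $ a $ b)))"
  by (simp add: inner_vec_def inner_complex_def)

lemma cadj_cadj [simp]: "cadj (cadj M) = M"
  by (simp add: vec_eq_iff cadj_def)

lemma cadj_matrix_mult: "cadj ((A::complex^'n^'m) ** B) = cadj B ** cadj A"
  by (simp add: vec_eq_iff cadj_def matrix_matrix_mult_def mult.commute)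

lemma inner_cadj: "inner (cadj E) (cadj F) = inner E F"
  unfolding inner_cmatrix cadj_def by (subst sum.swap) simp

lemma inner_matrix_mult_left: "inner (E::complex^'k^'m) ((K::complex^'n^'m) ** S) = inner (cadj K ** E) S"
proof -
  have "inner E (K ** S) = (\<Sum>a\<in>UNIV. \<Sum>b\<in>UNIV. \<Sum>c\<in>UNIV. Re (E$a$b * cnj (K$a$c) * cnj (S$c$b)))"
    unfolding inner_cmatrix matrix_matrix_mult_def by (simp add: sum_distrib_left Re_sum mult.assoc)
  also have "\<dots> = (\<Sum>c\<in>UNIV. \<Sum>b\<in>UNIV. \<Sum>a\<in>UNIV. Re (E$a$b * cnj (K$a$c) * cnj (S$c$b)))"
    by (subst (2) sum.swap, subst sum.swap, subst (2) sum.swap) (rule refl)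
  also have "\<dots> = inner (cadj K ** E) S"
    unfolding inner_cmatrix matrix_matrix_mult_def cadj_def
    by (simp only: vec_lambda_beta sum_distrib_right Re_sum)
      (intro sum.cong refl arg_cong[where f=Re]; simp only: mult_ac)
  finally show ?thesis .
qed

lemma inner_matrix_mult_right: "inner (E::complex^'k^'m) ((S::complex^'n^'m) ** X) = inner (E ** cadj X) S"
proof -
  have "inner E (S ** X) = inner (cadj E) (cadj (S ** X))"
    by (simp only: inner_cadj)
  also have "\<dots> = inner (cadj (E ** cadj X)) (cadj S)"
    by (simp only: cadj_matrix_mult inner_matrix_mult_left cadj_cadj)
  finally show ?thesis by (simp only: inner_cadj)
qed

lemma inner_smat_cmat: "inner (M::complex^'n^'m) (smat a (cmat H)) = inner H (remat (smat (cnj a) M))"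
  unfolding inner_cmatrix
  by (simp add: inner_vec_def smat_def cmat_def remat_def) (intro sum.cong refl, simp add: algebra_simps)

lemma inner_matrix_sandwich:
  "inner (E::complex^'k^'m) ((K::complex^'n^'m) ** M ** X) = inner (cadj K ** E ** cadj X) M"
  by (subst inner_matrix_mult_right, subst inner_matrix_mult_left) (simp add: matrix_mul_assoc)

section \<open>Entrywise conjugation\<close>

lemma mconj_matrix_mult: "mconj ((A::complex^'n^'m) ** B) = mconj A ** mconj B"
  by (simp add: vec_eq_iff mconj_def matrix_matrix_mult_def)

lemma mconj_mat_1: "mconj (mat 1 :: complex^'n^'n) = mat 1"
  by (simp add: vec_eq_iff mconj_def mat_def)

lemma mconj_diff: "mconj (A - B) = mconj A - mconj B"
  by (simp add: vec_eq_iff mconj_def)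

lemma mconj_sum: "mconj (sum f S) = (\<Sum>x\<in>S. mconj (f x))"
  by (simp add: vec_eq_iff mconj_def)

lemma mconj_smat: "mconj (smat c M) = smat (cnj c) (mconj M)"
  by (simp add: vec_eq_iff mconj_def smat_def)

lemma mconj_cadj: "mconj (cadj M) = cadj (mconj M)"
  by (simp add: vec_eq_iff mconj_def cadj_def)

lemma mconj_cmat: "mconj (cmat M) = cmat M"
  by (simp add: vec_eq_iff mconj_def cmat_def)

lemma cmat_remat_eq_iff: "cmat (remat M) = M \<longleftrightarrow> mconj M = M"
  by (auto simp: vec_eq_iff cmat_def remat_def mconj_def complex_eq_iff)

lemma matrix_inv_mconj:
  fixes Z :: "complex^'n^'n"
  assumes "invertible Z"
  shows "matrix_inv (mconj Z) = mconj (matrix_inv Z)"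
  using assms by (intro matrix_inv_unique)
    (simp_all add: matrix_inv_left matrix_inv_right mconj_mat_1 flip: mconj_matrix_mult)

lemma pmat_vconj:
  assumes "\<forall>i<q. f i (vconj p) = cnj (f i p)"
  shows "pmat q f M (vconj p) = mconj (pmat q f M p)"
  using assms by (simp add: pmat_def mconj_sum mconj_smat mconj_cmat)

section \<open>Derivatives of the reduced model\<close>

lemma bounded_linear_smat_cmat: "bounded_linear (\<lambda>H::real^'n^'m. smat a (cmat H))"
  unfolding linear_conv_bounded_linear[symmetric]
  by (rule linearI) (simp_all add: vec_eq_iff smat_def cmat_def distrib_left, simp add: scaleR_conv_of_real)

lemma pmat_fun_upd:
  assumes "i < q"
  shows "pmat q f (M(i := X)) p = pmat q f M p + smat (f i p) (cmat X - cmat (M i))"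
proof -
  have "pmat q f (M(i := X)) p - pmat q f M p
      = (\<Sum>i'<q. if i' = i then smat (f i p) (cmat X - cmat (M i)) else 0)"
    unfolding pmat_def sum_subtractf[symmetric]
    by (intro sum.cong refl) (auto simp: vec_eq_iff smat_def cmat_def algebra_simps)
  then show ?thesis
    using assms by (simp add: algebra_simps)
qed

lemma has_derivative_pmat_fun_upd:
  assumes "i < q"
  shows "((\<lambda>X. pmat q f (M(i := X)) p) has_derivative (\<lambda>H. smat (f i p) (cmat H))) (at X0)"
proof -
  have "pmat q f (M(i := X)) p = smat (f i p) (cmat X) + (pmat q f M p - smat (f i p) (cmat (M i)))" for X
    using pmat_fun_upd[OF assms] by (simp add: vec_eq_iff smat_def algebra_simps)
  then show ?thesis
    using bounded_linear.has_derivative[OF bounded_linear_smat_cmat has_derivative_ident]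
    by (auto intro!: derivative_eq_intros)
qed

lemma has_derivative_yhat_A:
  assumes "i < qA" and "invertible (pmat qA \<alpha> A p)"
  shows "((\<lambda>X. yhat qA \<alpha> (A(i := X)) qB \<beta> B qC \<gamma> C p) has_derivative
    (\<lambda>H. - (pmat qC \<gamma> C p ** matrix_inv (pmat qA \<alpha> A p) ** smat (\<alpha> i p) (cmat H)
            ** xhat qA \<alpha> A qB \<beta> B p))) (at (A i))"
proof -
  have "((\<lambda>X. matrix_inv (pmat qA \<alpha> (A(i := X)) p)) has_derivative
      (\<lambda>H. - (matrix_inv (pmat qA \<alpha> A p) ** smat (\<alpha> i p) (cmat H) ** matrix_inv (pmat qA \<alpha> A p))))
      (at (A i))"
    using has_derivative_compose[OF has_derivative_pmat_fun_upd[OF assms(1)]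
        has_derivative_matrix_inv[of "pmat qA \<alpha> (A(i := A i)) p"]] assms(2)
    unfolding fun_upd_triv by blast
  from bounded_linear.has_derivative[OF bounded_linear_compose[OF
        matrix_mult.bounded_linear_right matrix_mult.bounded_linear_left] this]
  show ?thesis
    unfolding yhat_def xhat_def
    by (simp add: matrix_mult.minus_left matrix_mult.minus_right matrix_mul_assoc)
qed

lemma has_derivative_yhat_B:
  assumes "j < qB"
  shows "((\<lambda>X. yhat qA \<alpha> A qB \<beta> (B(j := X)) qC \<gamma> C p) has_derivative
    (\<lambda>H. pmat qC \<gamma> C p ** matrix_inv (pmat qA \<alpha> A p) ** smat (\<beta> j p) (cmat H))) (at X0)"
  using bounded_linear.has_derivative[OF bounded_linear_compose[OF
        matrix_mult.bounded_linear_right matrix_mult.bounded_linear_right]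
        has_derivative_pmat_fun_upd[OF assms]]
  unfolding yhat_def xhat_def by (simp add: matrix_mul_assoc)

lemma has_derivative_yhat_C:
  assumes "k < qC"
  shows "((\<lambda>X. yhat qA \<alpha> A qB \<beta> B qC \<gamma> (C(k := X)) p) has_derivative
    (\<lambda>H. smat (\<gamma> k p) (cmat H) ** xhat qA \<alpha> A qB \<beta> B p)) (at X0)"
  using bounded_linear.has_derivative[OF matrix_mult.bounded_linear_left
      has_derivative_pmat_fun_upd[OF assms]]
  unfolding yhat_def .

lemma gderiv_mean_square_error:
  fixes yh :: "nat \<Rightarrow> real^'n^'m \<Rightarrow> complex^'f^'o" and U :: "nat \<Rightarrow> complex^'n^'m"
  assumes deriv: "\<And>l. l < N \<Longrightarrow> (yh l has_derivative d l) (at X0)"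
    and adjoint: "\<And>l H. l < N \<Longrightarrow> inner (yh l X0 - Y l) (d l H) = inner H (remat (U l))"
  shows "GDERIV (\<lambda>X. 1 / real N * (\<Sum>l<N. (frob (Y l - yh l X))\<^sup>2)) X0
           :> remat (smat (2 / of_nat N) (\<Sum>l<N. U l))"
proof -
  have "((\<lambda>X. inner (Y l - yh l X) (Y l - yh l X)) has_derivative
      (\<lambda>H. 2 * inner (yh l X0 - Y l) (d l H))) (at X0)" if "l < N" for l
    using deriv[OF that]
    by (auto intro!: derivative_eq_intros
        simp: inner_diff_left inner_diff_right inner_commute[of "d l _"])
  then have "((\<lambda>X. 1 / real N * (\<Sum>l<N. inner (Y l - yh l X) (Y l - yh l X))) has_derivative
      (\<lambda>H. 1 / real N * (\<Sum>l<N. 2 * inner (yh l X0 - Y l) (d l H)))) (at X0)"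
    by (intro derivative_intros) auto
  moreover have "remat (smat (2 / of_nat N) (\<Sum>l<N. U l)) = (2 / real N) *\<^sub>R (\<Sum>l<N. remat (U l))"
    by (simp add: vec_eq_iff remat_def smat_def Re_sum sum_distrib_left)
  then have "1 / real N * (\<Sum>l<N. 2 * inner (yh l X0 - Y l) (d l H))
      = inner H (remat (smat (2 / of_nat N) (\<Sum>l<N. U l)))" for H
    by (simp add: adjoint inner_sum_right sum_distrib_left)
  ultimately show ?thesis
    unfolding gderiv_def frob_eq_norm power2_norm_eq_inner by simp
qed

section \<open>Gradients of the mean squared error\<close>

lemma inR_empmeas_imp_invertible:
  assumes "inR (empmeas N P) qA \<alpha> A" and "l < N"
  shows "invertible (pmat qA \<alpha> A (P l))"
proof -
  have "P l \<in># mset (map P [0..<N])"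
    using assms(2) by simp
  then have nonempty: "mset (map P [0..<N]) \<noteq> {#}"
    by (metis empty_iff set_mset_empty)
  have "AE p in empmeas N P. invertible (pmat qA \<alpha> A p)"
    using assms(1) unfolding inR_def by blast
  then have "\<forall>p\<in>#mset (map P [0..<N]). invertible (pmat qA \<alpha> A p)"
    unfolding empmeas_def AE_measure_pmf_iff set_pmf_of_multiset[OF nonempty] .
  with \<open>P l \<in># mset (map P [0..<N])\<close> show ?thesis by blast
qed

lemma conj_closed_permutation:
  assumes "mset (map (\<lambda>l. (P l, Y l)) [0..<N]) = mset (map (\<lambda>l. (vconj (P l), mconj (Y l))) [0..<N])"
  obtains \<sigma> where "\<sigma> permutes {..<N}"
    and "\<And>l. l < N \<Longrightarrow> P (\<sigma> l) = vconj (P l) \<and> Y (\<sigma> l) = mconj (Y l)"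
proof -
  let ?samples = "map (\<lambda>l. (P l, Y l)) [0..<N]"
  obtain \<sigma> where \<sigma>: "\<sigma> permutes {..<N}"
    and "permute_list \<sigma> ?samples = map (\<lambda>l. (vconj (P l), mconj (Y l))) [0..<N]"
    using mset_eq_permutation[OF assms[symmetric]] by auto
  moreover have "permute_list \<sigma> ?samples ! l = (P (\<sigma> l), Y (\<sigma> l))" if "l < N" for l
    using \<sigma> that permutes_in_image[OF \<sigma>, of l] by (simp add: permute_list_nth)
  ultimately show ?thesis
    using that by auto
qed

lemma mconj_sum_permutes:
  assumes "\<sigma> permutes {..<N}" and "\<And>l. l < N \<Longrightarrow> mconj (S l) = S (\<sigma> l)"
  shows "mconj (\<Sum>l<N. S l) = (\<Sum>l<N. S l)"
proof -
  have "mconj (\<Sum>l<N. S l) = (\<Sum>l<N. S (\<sigma> l))"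
    using assms(2) by (simp add: mconj_sum)
  also have "\<dots> = (\<Sum>l<N. S l)"
    using sum.permute[OF assms(1), of S] by simp
  finally show ?thesis .
qed

lemma xhat_vconj:
  assumes "invertible (pmat qA \<alpha> A p)"
    and "\<forall>i<qA. \<alpha> i (vconj p) = cnj (\<alpha> i p)" and "\<forall>j<qB. \<beta> j (vconj p) = cnj (\<beta> j p)"
  shows "xhat qA \<alpha> A qB \<beta> B (vconj p) = mconj (xhat qA \<alpha> A qB \<beta> B p)"
  using assms by (simp add: xhat_def pmat_vconj matrix_inv_mconj mconj_matrix_mult)

lemma yhat_vconj:
  assumes "invertible (pmat qA \<alpha> A p)" and "\<forall>i<qA. \<alpha> i (vconj p) = cnj (\<alpha> i p)"
    and "\<forall>j<qB. \<beta> j (vconj p) = cnj (\<beta> j p)" and "\<forall>k<qC. \<gamma> k (vconj p) = cnj (\<gamma> k p)"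
  shows "yhat qA \<alpha> A qB \<beta> B qC \<gamma> C (vconj p) = mconj (yhat qA \<alpha> A qB \<beta> B qC \<gamma> C p)"
  using assms by (simp add: yhat_def xhat_vconj pmat_vconj mconj_matrix_mult)

lemma xdual_vconj:
  assumes "invertible (pmat qA \<alpha> A p)"
    and "\<forall>i<qA. \<alpha> i (vconj p) = cnj (\<alpha> i p)" and "\<forall>k<qC. \<gamma> k (vconj p) = cnj (\<gamma> k p)"
  shows "xdual qA \<alpha> A qC \<gamma> C (vconj p) = mconj (xdual qA \<alpha> A qC \<gamma> C p)"
  using assms by (simp add: xdual_def pmat_vconj matrix_inv_mconj mconj_matrix_mult mconj_cadj)

lemma Jmse_has_gradient_A:
  assumes i: "i < qA" and inv: "\<And>l. l < N \<Longrightarrow> invertible (pmat qA \<alpha> A (P l))"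
    and \<alpha>_conj: "\<forall>i<qA. \<forall>l<N. \<alpha> i (vconj (P l)) = cnj (\<alpha> i (P l))"
  shows "GDERIV (\<lambda>X. Jmse N P Y qA \<alpha> (A(i := X)) qB \<beta> B qC \<gamma> C) (A i)
    :> remat (smat (2 / of_nat N) (\<Sum>l<N. smat (\<alpha> i (vconj (P l)))
         (xdual qA \<alpha> A qC \<gamma> C (P l) ** (Y l - yhat qA \<alpha> A qB \<beta> B qC \<gamma> C (P l))
          ** cadj (xhat qA \<alpha> A qB \<beta> B (P l)))))"
  unfolding Jmse_def
proof (rule gderiv_mean_square_error[OF has_derivative_yhat_A[OF i inv]])
  fix l H assume l: "l < N"
  show "inner (yhat qA \<alpha> (A(i := A i)) qB \<beta> B qC \<gamma> C (P l) - Y l)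
      (- (pmat qC \<gamma> C (P l) ** matrix_inv (pmat qA \<alpha> A (P l)) ** smat (\<alpha> i (P l)) (cmat H)
          ** xhat qA \<alpha> A qB \<beta> B (P l)))
    = inner H (remat (smat (\<alpha> i (vconj (P l)))
         (xdual qA \<alpha> A qC \<gamma> C (P l) ** (Y l - yhat qA \<alpha> A qB \<beta> B qC \<gamma> C (P l))
          ** cadj (xhat qA \<alpha> A qB \<beta> B (P l)))))"
    (is "inner ?residual (- ?D) = _")
  proof -
    have "inner ?residual (- ?D) = inner (Y l - yhat qA \<alpha> A qB \<beta> B qC \<gamma> C (P l)) ?D"
      by (simp only: fun_upd_triv inner_minus_right minus_diff_eq flip: inner_minus_left)
    also have "\<dots> = inner H (remat (smat (\<alpha> i (vconj (P l)))
         (xdual qA \<alpha> A qC \<gamma> C (P l) ** (Y l - yhat qA \<alpha> A qB \<beta> B qC \<gamma> C (P l))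
          ** cadj (xhat qA \<alpha> A qB \<beta> B (P l)))))"
      by (simp add: inner_matrix_sandwich inner_smat_cmat xdual_def cadj_matrix_mult \<alpha>_conj i l)
    finally show ?thesis .
  qed
qed

lemma Jmse_has_gradient_B:
  assumes j: "j < qB"
    and \<beta>_conj: "\<forall>j<qB. \<forall>l<N. \<beta> j (vconj (P l)) = cnj (\<beta> j (P l))"
  shows "GDERIV (\<lambda>X. Jmse N P Y qA \<alpha> A qB \<beta> (B(j := X)) qC \<gamma> C) (B j)
    :> remat (smat (2 / of_nat N) (\<Sum>l<N. smat (\<beta> j (vconj (P l)))
         (xdual qA \<alpha> A qC \<gamma> C (P l) ** (yhat qA \<alpha> A qB \<beta> B qC \<gamma> C (P l) - Y l))))"
  unfolding Jmse_def
proof (rule gderiv_mean_square_error[OF has_derivative_yhat_B[OF j]])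
  fix l H assume l: "l < N"
  show "inner (yhat qA \<alpha> A qB \<beta> (B(j := B j)) qC \<gamma> C (P l) - Y l)
      (pmat qC \<gamma> C (P l) ** matrix_inv (pmat qA \<alpha> A (P l)) ** smat (\<beta> j (P l)) (cmat H))
    = inner H (remat (smat (\<beta> j (vconj (P l)))
         (xdual qA \<alpha> A qC \<gamma> C (P l) ** (yhat qA \<alpha> A qB \<beta> B qC \<gamma> C (P l) - Y l))))"
    by (simp add: inner_matrix_mult_left inner_smat_cmat xdual_def cadj_matrix_mult \<beta>_conj j l
        matrix_mul_assoc)
qed

lemma Jmse_has_gradient_C:
  assumes k: "k < qC"
    and \<gamma>_conj: "\<forall>k<qC. \<forall>l<N. \<gamma> k (vconj (P l)) = cnj (\<gamma> k (P l))"
  shows "GDERIV (\<lambda>X. Jmse N P Y qA \<alpha> A qB \<beta> B qC \<gamma> (C(k := X))) (C k)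
    :> remat (smat (2 / of_nat N) (\<Sum>l<N. smat (\<gamma> k (vconj (P l)))
         ((yhat qA \<alpha> A qB \<beta> B qC \<gamma> C (P l) - Y l) ** cadj (xhat qA \<alpha> A qB \<beta> B (P l)))))"
  unfolding Jmse_def
proof (rule gderiv_mean_square_error[OF has_derivative_yhat_C[OF k]])
  fix l H assume l: "l < N"
  show "inner (yhat qA \<alpha> A qB \<beta> B qC \<gamma> (C(k := C k)) (P l) - Y l)
      (smat (\<gamma> k (P l)) (cmat H) ** xhat qA \<alpha> A qB \<beta> B (P l))
    = inner H (remat (smat (\<gamma> k (vconj (P l)))
         ((yhat qA \<alpha> A qB \<beta> B qC \<gamma> C (P l) - Y l) ** cadj (xhat qA \<alpha> A qB \<beta> B (P l)))))"
    by (simp add: inner_matrix_mult_right inner_smat_cmat \<gamma>_conj k l)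
qed

theorem corollary1:
  fixes N :: nat
    and P :: "nat \<Rightarrow> complex^'p::finite"
    and Y :: "nat \<Rightarrow> complex^'f::finite^'o::finite"
    and qA qB qC :: nat
    and \<alpha> \<beta> \<gamma> :: "nat \<Rightarrow> complex^'p \<Rightarrow> complex"
    and A :: "nat \<Rightarrow> real^'r::finite^'r"
    and B :: "nat \<Rightarrow> real^'f^'r"
    and C :: "nat \<Rightarrow> real^'r^'o"
  defines "\<mu> \<equiv> empmeas N P"
  assumes N_pos: "0 < N"
    and conj_closed: "mset (map (\<lambda>l. (P l, Y l)) [0..<N])
                    = mset (map (\<lambda>l. (vconj (P l), mconj (Y l))) [0..<N])"
    and \<alpha>_conj: "\<forall>i<qA. \<forall>l<N. \<alpha> i (vconj (P l)) = cnj (\<alpha> i (P l))"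
    and \<beta>_conj: "\<forall>j<qB. \<forall>l<N. \<beta> j (vconj (P l)) = cnj (\<beta> j (P l))"
    and \<gamma>_conj: "\<forall>k<qC. \<forall>l<N. \<gamma> k (vconj (P l)) = cnj (\<gamma> k (P l))"
    and integrable: "(\<integral>\<^sup>+ p. ((ennreal (\<Sum>j<qB. cmod (\<beta> j p)) * ennreal (\<Sum>k<qC. cmod (\<gamma> k p)))
                          / ennreal (\<Sum>i<qA. cmod (\<alpha> i p))) ^ 2 \<partial>\<mu>) < \<infinity>"
    and R: "inR \<mu> qA \<alpha> A"
  shows
   "(\<forall>i<qA. let G = smat (2 / of_nat N) (\<Sum>l<N. smat (\<alpha> i (vconj (P l)))
                  (xdual qA \<alpha> A qC \<gamma> C (P l) ** (Y l - yhat qA \<alpha> A qB \<beta> B qC \<gamma> C (P l))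
                   ** cadj (xhat qA \<alpha> A qB \<beta> B (P l))))
     in cmat (remat G) = G \<and>
        (GDERIV (\<lambda>X. Jmse N P Y qA \<alpha> (A(i := X)) qB \<beta> B qC \<gamma> C) (A i) :> remat G)) \<and>
    (\<forall>j<qB. let G = smat (2 / of_nat N) (\<Sum>l<N. smat (\<beta> j (vconj (P l)))
                  (xdual qA \<alpha> A qC \<gamma> C (P l) ** (yhat qA \<alpha> A qB \<beta> B qC \<gamma> C (P l) - Y l)))
     in cmat (remat G) = G \<and>
        (GDERIV (\<lambda>X. Jmse N P Y qA \<alpha> A qB \<beta> (B(j := X)) qC \<gamma> C) (B j) :> remat G)) \<and>
    (\<forall>k<qC. let G = smat (2 / of_nat N) (\<Sum>l<N. smat (\<gamma> k (vconj (P l)))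
                  ((yhat qA \<alpha> A qB \<beta> B qC \<gamma> C (P l) - Y l) ** cadj (xhat qA \<alpha> A qB \<beta> B (P l))))
     in cmat (remat G) = G \<and>
        (GDERIV (\<lambda>X. Jmse N P Y qA \<alpha> A qB \<beta> B qC \<gamma> (C(k := X))) (C k) :> remat G))"
proof -
  (* Only the a.e. invertibility in R is used: for the empirical measure all sums are finite. *)
  have inv: "\<And>l. l < N \<Longrightarrow> invertible (pmat qA \<alpha> A (P l))"
    using R unfolding \<mu>_def by (rule inR_empmeas_imp_invertible)
  obtain \<sigma> where \<sigma>: "\<sigma> permutes {..<N}"
    and \<sigma>_conj: "\<And>l. l < N \<Longrightarrow> P (\<sigma> l) = vconj (P l) \<and> Y (\<sigma> l) = mconj (Y l)"
    using conj_closed_permutation[OF conj_closed] by blast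
  have model_conj:
    "xhat qA \<alpha> A qB \<beta> B (vconj (P l)) = mconj (xhat qA \<alpha> A qB \<beta> B (P l))"
    "yhat qA \<alpha> A qB \<beta> B qC \<gamma> C (vconj (P l)) = mconj (yhat qA \<alpha> A qB \<beta> B qC \<gamma> C (P l))"
    "xdual qA \<alpha> A qC \<gamma> C (vconj (P l)) = mconj (xdual qA \<alpha> A qC \<gamma> C (P l))" if "l < N" for l
    using inv[OF that] \<alpha>_conj \<beta>_conj \<gamma>_conj that
    by (simp_all add: xhat_vconj yhat_vconj xdual_vconj)
  show ?thesis
    unfolding Let_def cmat_remat_eq_iff
    using Jmse_has_gradient_A[OF _ inv \<alpha>_conj] Jmse_has_gradient_B[OF _ \<beta>_conj]
      Jmse_has_gradient_C[OF _ \<gamma>_conj]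
    by (auto simp: mconj_sum_permutes[OF \<sigma>] \<sigma>_conj model_conj \<alpha>_conj \<beta>_conj \<gamma>_conj
        mconj_smat mconj_matrix_mult mconj_diff mconj_cadj)
qed

end
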